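(* Let $f:(0,\infty)\to\mathbb{R}$ be convex, strictly convex at $1$, with $f(1)=0$. For all $\mu_1,\mu_2\in\mathbb{R}$ and $\sigma_1,\sigma_2>0$, the $f$-divergence between two log-Cauchy distributions equals the $f$-divergence between the two corresponding Cauchy distributions: $$I_f(p^{\mathrm{lc}}_{\mu_1,\sigma_1}:p^{\mathrm{lc}}_{\mu_2,\sigma_2})=I_f(p_{\mu_1,\sigma_1}:p_{\mu_2,\sigma_2}).$$ Consequently the $f$-divergences between two log-Cauchy distributions are symmetric and can be expressed as a scalar function (depending only on $f$) of the chi-squared divergence $\chi((\mu_1,\sigma_1),(\mu_2,\sigma_2))$.
   Context: For densities $p,q$ strictly positive on a common domain $\mathcal X$ (with respect to Lebesgue measure), $I_f(p:q):=\int_{\mathcal X}p\,f(q/p)\,dx$. The log-Cauchy density is $p^{\mathrm{lc}}_{\mu,\sigma}(y)=\frac{1}{\pi y}\,\frac{\sigma}{(\log y-\mu)^2+\sigma^2}$ on $(0,\infty)$. The Cauchy density is $p_{l,s}(x)=\frac{s}{\pi(s^2+(x-l)^2)}$ on $\mathbb{R}$. $\chi((l_1,s_1),(l_2,s_2)):=\frac{(l_1-l_2)^2+(s_1-s_2)^2}{2s_1s_2}$, which equals the chi-squared divergence $\int_{\mathbb{R}}\frac{(p_{l_1,s_1}-p_{l_2,s_2})^2}{p_{l_1,s_1}}dx$. *)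

theory Defs
  imports "HOL-Analysis.Analysis"
begin

definition cauchy_density :: "real \<Rightarrow> real \<Rightarrow> real \<Rightarrow> real" where
  "cauchy_density l s x = s / (pi * (s\<^sup>2 + (x - l)\<^sup>2))"

text \<open>A density on the open half-line \<open>{0<..}\<close> only; values elsewhere are meaningless.\<close>

definition log_cauchy_density :: "real \<Rightarrow> real \<Rightarrow> real \<Rightarrow> real" where
  "log_cauchy_density m s y = 1 / (pi * y) * (s / ((ln y - m)\<^sup>2 + s\<^sup>2))"

text \<open>The integral below is a Bochner integral, which is \<open>0\<close> by convention when the integrand is not
  integrable; \<open>f_div_integrable\<close> says that the divergence is a genuine finite integral. The
  generator \<open>f\<close> is only evaluated on \<open>{0<..}\<close> when both densities are strictly positive on \<open>X\<close>.\<close>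

definition f_div_integrable ::
    "(real \<Rightarrow> real) \<Rightarrow> real set \<Rightarrow> (real \<Rightarrow> real) \<Rightarrow> (real \<Rightarrow> real) \<Rightarrow> bool" where
  "f_div_integrable f X p q \<longleftrightarrow> set_integrable lborel X (\<lambda>x. p x * f (q x / p x))"

definition f_div ::
    "(real \<Rightarrow> real) \<Rightarrow> real set \<Rightarrow> (real \<Rightarrow> real) \<Rightarrow> (real \<Rightarrow> real) \<Rightarrow> real" where
  "f_div f X p q = (LINT x:X|lborel. p x * f (q x / p x))"

text \<open>Closed form of the chi-squared divergence between two Cauchy densities,
  \<open>\<integral> (p\<^sub>1 - p\<^sub>2)\<^sup>2 / p\<^sub>1\<close> over the real line; the arguments are (location, scale) pairs.\<close>

definition cauchy_chi :: "real \<times> real \<Rightarrow> real \<times> real \<Rightarrow> real" where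
  "cauchy_chi = (\<lambda>(l1, s1) (l2, s2). ((l1 - l2)\<^sup>2 + (s1 - s2)\<^sup>2) / (2 * s1 * s2))"

definition strictly_convex_at :: "real set \<Rightarrow> (real \<Rightarrow> real) \<Rightarrow> real \<Rightarrow> bool" where
  "strictly_convex_at S f a \<longleftrightarrow>
     (\<forall>x\<in>S. \<forall>y\<in>S. \<forall>t. 0 < t \<and> t < 1 \<and> x \<noteq> y \<and> (1 - t) * x + t * y = a
        \<longrightarrow> f a < (1 - t) * f x + t * f y)"

end

theory Submission
  imports Defs
begin

text \<open>Both kinds of divergence reduce to one integral over an angle. The exponential map carries the
  log-Cauchy integrand to the Cauchy integrand. Substituting \<open>x = l1 + s1 * tan t\<close> turns the first
  Cauchy density into the constant \<open>1 / pi\<close> on \<open>]-pi/2, pi/2[\<close> and the density ratio into the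
  reciprocal of \<open>A + sqrt (A\<^sup>2 - 1) * cos (2 * t - \<phi>)\<close> with \<open>A = 1 + \<chi>\<close>. The phase \<open>\<phi>\<close> is irrelevant
  because one integrates over a full period, so only \<open>\<chi>\<close> matters, and \<open>\<chi>\<close> is symmetric.\<close>

section \<open>Change of variables for continuous integrands, and shifts of periodic ones\<close>

lemma set_integrable_lborel_iff_lebesgue:
  fixes g :: "real \<Rightarrow> real"
  assumes "continuous_on S g" and "S \<in> sets borel"
  shows "set_integrable lborel S g \<longleftrightarrow> g absolutely_integrable_on S"
    and "set_lebesgue_integral lborel S g = set_lebesgue_integral lebesgue S g"
proof -
  have "(\<lambda>x. indicator S x *\<^sub>R g x) \<in> borel_measurable lborel"
    using borel_measurable_continuous_on_indicator[OF assms(2,1)] by simp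
  then show "set_integrable lborel S g \<longleftrightarrow> g absolutely_integrable_on S"
    and "set_lebesgue_integral lborel S g = set_lebesgue_integral lebesgue S g"
    by (simp_all add: set_integrable_def set_lebesgue_integral_def
        integrable_completion integral_completion)
qed

text \<open>Change of variables for absolutely integrable functions gives the result for
  \<open>lebesgue\<close>; continuity of \<open>k\<close> and \<open>u\<close> carries it to
  \<open>lborel\<close>. Integrability is assumed for the pulled-back integrand \<open>u\<close> and
  transferred to \<open>k\<close>, which is how finiteness of the divergences is obtained.\<close>

lemma set_integral_substitution_lborel:
  fixes k g g' :: "real \<Rightarrow> real"
  assumes S: "S \<in> sets borel" and T: "g ` S \<in> sets borel"
    and der: "\<And>x. x \<in> S \<Longrightarrow> (g has_real_derivative g' x) (at x)"
    and inj: "inj_on g S"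
    and cont_k: "continuous_on (g ` S) k"
    and pull: "\<And>x. x \<in> S \<Longrightarrow> \<bar>g' x\<bar> * k (g x) = u x"
    and cont_u: "continuous_on S u"
    and int: "set_integrable lborel S u"
  shows "set_integrable lborel (g ` S) k"
    and "set_lebesgue_integral lborel (g ` S) k = set_lebesgue_integral lborel S u"
proof -
  have u: "u absolutely_integrable_on S"
    using int set_integrable_lborel_iff_lebesgue(1)[OF cont_u S] by simp
  have "(\<lambda>x. \<bar>g' x\<bar> * k (g x)) absolutely_integrable_on S"
    using u by (rule set_integrable_cong[THEN iffD2, rotated -1]) (use pull in auto)
  moreover have "integral S (\<lambda>x. \<bar>g' x\<bar> * k (g x)) = integral S u"
    by (rule integral_cong) (rule pull)
  moreover have "S \<in> sets lebesgue"
    using S by (metis sets_completionI_sets sets_lborel)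
  ultimately have k: "k absolutely_integrable_on (g ` S)" "integral (g ` S) k = integral S u"
    using has_absolute_integral_change_of_variables_1'[of S g g' k "integral S u"] der inj
    by (auto intro: has_field_derivative_at_within)
  show "set_integrable lborel (g ` S) k"
    using k(1) set_integrable_lborel_iff_lebesgue(1)[OF cont_k T] by simp
  show "set_lebesgue_integral lborel (g ` S) k = set_lebesgue_integral lborel S u"
    using k u set_lebesgue_integral_eq_integral set_integrable_lborel_iff_lebesgue(2)[OF cont_k T]
      set_integrable_lborel_iff_lebesgue(2)[OF cont_u S] by metis
qed

text \<open>The shifted window is cut at \<open>a\<close>, and the piece left of \<open>a\<close> is
  moved one period to the right end. The bounds on \<open>c\<close> put the cut inside the
  window.\<close>

lemma integral_periodic:
  fixes g :: "real \<Rightarrow> real"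
  assumes cont: "continuous_on UNIV g" and per: "\<And>x. g (x + T) = g x"
    and c: "0 \<le> c" "c \<le> T"
  shows "integral {a..a + T} (\<lambda>x. g (x - c)) = integral {a..a + T} g"
proof -
  have I: "g integrable_on {p..q}" for p q
    by (rule integrable_continuous_real) (rule continuous_on_subset[OF cont], simp)
  have "integral {a..a + T} (\<lambda>x. g (x - c)) = integral {a - c..a + T - c} g"
    using integral_shift_real_ivl[where a = "a - c" and b = "a + T - c" and c = "- c" and f = g] by simp
  also have "\<dots> = integral {a - c..a} g + integral {a..a + T - c} g"
    using Henstock_Kurzweil_Integration.integral_combine[where a = "a - c" and c = a and b = "a + T - c" and f = g] I c by simp
  also have "integral {a - c..a} g = integral {a - c..a} (\<lambda>x. g (x + T))"
    by (simp add: per)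
  also have "\<dots> = integral {a + T - c..a + T} g"
    using integral_shift_real_ivl[where a = "a + T - c" and b = "a + T" and c = T and f = g] by simp
  also have "\<dots> + integral {a..a + T - c} g = integral {a..a + T} g"
    using Henstock_Kurzweil_Integration.integral_combine[where a = a and c = "a + T - c" and b = "a + T" and f = g] I c by simp
  finally show ?thesis .
qed

section \<open>The densities and the exponential substitution\<close>

lemma cauchy_density_pos: "s > 0 \<Longrightarrow> cauchy_density l s x > 0"
  by (simp add: cauchy_density_def pos_add_strict add_pos_nonneg)

lemma continuous_on_cauchy_density: "s > 0 \<Longrightarrow> continuous_on X (cauchy_density l s)"
  unfolding cauchy_density_def
  by (intro continuous_intros) (simp add: add_pos_nonneg less_imp_neq[symmetric])

text \<open>The factor \<open>1 / y\<close> is the derivative of \<open>ln\<close>: this is the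
  density of the exponential of a Cauchy variable. At \<open>y = 0\<close> both sides are
  \<open>0\<close>, since division by zero gives \<open>0\<close>.\<close>

lemma log_cauchy_density_eq:
  "log_cauchy_density m s y = cauchy_density m s (ln y) / y"
  by (simp add: log_cauchy_density_def cauchy_density_def field_simps)

lemma log_cauchy_ratio:
  "y > 0 \<Longrightarrow> log_cauchy_density m2 s2 y / log_cauchy_density m1 s1 y
     = cauchy_density m2 s2 (ln y) / cauchy_density m1 s1 (ln y)"
  by (simp add: log_cauchy_density_eq)

lemma continuous_on_cauchy_integrand:
  assumes f: "continuous_on {0<..} f" and s: "s1 > 0" "s2 > 0"
  shows "continuous_on X (\<lambda>x. cauchy_density l1 s1 x *
           f (cauchy_density l2 s2 x / cauchy_density l1 s1 x))"
proof -
  have [simp]: "cauchy_density l1 s1 x \<noteq> 0" for x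
    using cauchy_density_pos[OF s(1), of l1 x] by simp
  show ?thesis
    by (intro continuous_on_mult continuous_on_compose2[OF f] continuous_on_divide
        continuous_on_cauchy_density s) (auto simp: cauchy_density_pos s)
qed

text \<open>Under \<open>y = exp x\<close> the Jacobian cancels the \<open>1 / y\<close> of the
  first density, while in the ratio the two factors \<open>1 / y\<close> cancel each other.\<close>

lemma f_div_log_cauchy:
  assumes f: "continuous_on {0<..} f" and s: "s1 > 0" "s2 > 0"
    and int: "f_div_integrable f UNIV (cauchy_density m1 s1) (cauchy_density m2 s2)"
  shows "f_div_integrable f {0<..} (log_cauchy_density m1 s1) (log_cauchy_density m2 s2)"
    and "f_div f {0<..} (log_cauchy_density m1 s1) (log_cauchy_density m2 s2)
       = f_div f UNIV (cauchy_density m1 s1) (cauchy_density m2 s2)"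
proof -
  define u where "u x = cauchy_density m1 s1 x *
    f (cauchy_density m2 s2 x / cauchy_density m1 s1 x)" for x
  define k where "k y = log_cauchy_density m1 s1 y *
    f (log_cauchy_density m2 s2 y / log_cauchy_density m1 s1 y)" for y
  have k: "k y = u (ln y) / y" if "y > 0" for y
    unfolding k_def u_def log_cauchy_ratio[OF that] by (simp add: log_cauchy_density_eq)
  have cont_u: "continuous_on X u" for X
    using continuous_on_cauchy_integrand[OF f s] by (simp add: u_def)
  have "continuous_on {0<..} (\<lambda>y. u (ln y) / y)"
    by (intro continuous_on_divide continuous_on_compose2[OF cont_u[of UNIV]]
        continuous_intros) auto
  then have cont_k: "continuous_on {0<..} k"
    by (rule continuous_on_eq) (simp add: k)
  have range: "range (exp :: real \<Rightarrow> real) = {0<..}"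
    by (auto simp: image_iff) (metis exp_ln)
  have pull: "\<bar>exp x\<bar> * k (exp x) = u x" for x
    by (simp add: k)
  have int_u: "set_integrable lborel UNIV u"
    using int unfolding f_div_integrable_def u_def .
  have sub: "set_integrable lborel (range exp) k"
    "set_lebesgue_integral lborel (range exp) k = set_lebesgue_integral lborel UNIV u"
    by (rule set_integral_substitution_lborel[OF _ _ DERIV_exp _ _ pull cont_u int_u];
        simp add: range cont_k inj_on_def)+
  show "f_div_integrable f {0<..} (log_cauchy_density m1 s1) (log_cauchy_density m2 s2)"
    and "f_div f {0<..} (log_cauchy_density m1 s1) (log_cauchy_density m2 s2)
       = f_div f UNIV (cauchy_density m1 s1) (cauchy_density m2 s2)"
    using sub unfolding f_div_integrable_def f_div_def k_def u_def range .
qed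

text \<open>For \<open>c \<ge> 0\<close>, writing \<open>1 + c = cosh r\<close> turns the argument
  of \<open>f\<close> into \<open>1 / (cosh r + sinh r * cos (2 * t))\<close>, a Poisson kernel of
  the unit disc. It is averaged over one full period of \<open>cos (2 * t)\<close>.\<close>

definition cauchy_angle_integral :: "(real \<Rightarrow> real) \<Rightarrow> real \<Rightarrow> real" where
  "cauchy_angle_integral f c =
     integral {-(pi/2)..pi/2} (\<lambda>t. f (1 / (1 + c + sqrt ((1 + c)\<^sup>2 - 1) * cos (2 * t)))) / pi"

section \<open>Trigonometric form of the density ratio\<close>

lemma cauchy_chi_nonneg: "s1 > 0 \<Longrightarrow> s2 > 0 \<Longrightarrow> cauchy_chi (l1, s1) (l2, s2) \<ge> 0"
  by (simp add: cauchy_chi_def)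

text \<open>The amplitude is strictly below the constant term, so the cosine cannot cancel it. This
  keeps the argument of \<open>f\<close> in \<open>{0<..}\<close>.\<close>

lemma angle_denominator_pos:
  fixes c :: real
  assumes "c \<ge> 0"
  shows "1 + c + sqrt ((1 + c)\<^sup>2 - 1) * cos t > 0"
proof -
  have "sqrt ((1 + c)\<^sup>2 - 1) < sqrt ((1 + c)\<^sup>2)"
    by (rule real_sqrt_less_mono) simp
  then have "sqrt ((1 + c)\<^sup>2 - 1) < 1 + c"
    using assms by simp
  moreover have "sqrt ((1 + c)\<^sup>2 - 1) * (- cos t) \<le> sqrt ((1 + c)\<^sup>2 - 1) * 1"
    using assms cos_ge_minus_one[of t] by (intro mult_left_mono) (auto simp: one_le_power)
  ultimately show ?thesis by simp
qed

text \<open>Polar coordinates of \<open>(B, C)\<close>. The range of the angle matters later: its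
  half must lie between \<open>0\<close> and the period \<open>pi\<close>.\<close>

lemma polar_form:
  fixes B C :: real
  obtains \<phi> where "0 \<le> \<phi>" "\<phi> \<le> 2 * pi"
    "B = sqrt (B\<^sup>2 + C\<^sup>2) * cos \<phi>" "C = sqrt (B\<^sup>2 + C\<^sup>2) * sin \<phi>"
proof (cases "B\<^sup>2 + C\<^sup>2 = 0")
  case True
  then have "B = 0" "C = 0" by (simp_all add: sum_power2_eq_zero_iff)
  then show ?thesis using that[of 0] by simp
next
  case False
  let ?R = "sqrt (B\<^sup>2 + C\<^sup>2)"
  have R: "?R \<noteq> 0" using False by simp
  have "(B / ?R)\<^sup>2 + (C / ?R)\<^sup>2 = 1"
    using False by (simp add: power_divide flip: add_divide_distrib)
  from sincos_total_2pi_le[OF this] obtain \<phi> where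
    "0 \<le> \<phi>" "\<phi> \<le> 2 * pi" "B / ?R = cos \<phi>" "C / ?R = sin \<phi>" by blast
  then show ?thesis using that[of \<phi>] R by (simp add: field_simps)
qed

text \<open>By \<open>1 + tan\<^sup>2 = 1 / cos\<^sup>2\<close>; the result times the Jacobian
  \<open>s / (cos t)\<^sup>2\<close> is the constant \<open>1 / pi\<close>.\<close>

lemma cauchy_density_tan:
  assumes "s > 0" and "cos t \<noteq> 0"
  shows "cauchy_density l s (l + s * tan t) = (cos t)\<^sup>2 / (pi * s)"
proof -
  have "s\<^sup>2 + (s * tan t)\<^sup>2 = s\<^sup>2 * (1 + (tan t)\<^sup>2)"
    by (simp add: algebra_simps)
  also have "\<dots> = s\<^sup>2 / (cos t)\<^sup>2"
    using tan_sec[OF assms(2)] by (simp add: power_inverse divide_inverse)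
  finally show ?thesis
    using assms by (simp add: cauchy_density_def power2_eq_square)
qed

text \<open>The reciprocal ratio is a quadratic form in \<open>cos t\<close> and
  \<open>sin t\<close>, hence a constant plus a sinusoid in \<open>2 * t\<close>. The phase is
  chosen before \<open>t\<close>, so it serves all angles at once.\<close>

lemma cauchy_ratio_tan:
  assumes s: "s1 > 0" "s2 > 0"
  obtains \<phi> where "0 \<le> \<phi>" "\<phi> \<le> 2 * pi"
    "\<And>t. cos t \<noteq> 0 \<Longrightarrow>
       cauchy_density l2 s2 (l1 + s1 * tan t) / cauchy_density l1 s1 (l1 + s1 * tan t)
       = 1 / (1 + cauchy_chi (l1, s1) (l2, s2)
              + sqrt ((1 + cauchy_chi (l1, s1) (l2, s2))\<^sup>2 - 1) * cos (2 * t - \<phi>))"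
proof -
  define d where "d = l1 - l2"
  define A where "A = 1 + cauchy_chi (l1, s1) (l2, s2)"
  \<comment> \<open>\<open>A\<close>, \<open>B\<close> and \<open>C\<close> are the coefficients of
    \<open>1\<close>, \<open>cos (2 * t)\<close> and \<open>sin (2 * t)\<close> in the reciprocal
    ratio.\<close>
  define B where "B = (s2\<^sup>2 + d\<^sup>2 - s1\<^sup>2) / (2 * s1 * s2)"
  define C where "C = d / s2"
  have A: "A = (s1\<^sup>2 + s2\<^sup>2 + d\<^sup>2) / (2 * s1 * s2)"
    using s by (simp add: A_def d_def cauchy_chi_def field_simps power2_eq_square)
  \<comment> \<open>The quadratic form has diagonal entries \<open>A + B\<close>,
    \<open>A - B\<close> and off-diagonal entry \<open>C\<close>; its determinant is 1. Hence the
    amplitude depends on \<open>A\<close> alone.\<close>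
  have sq: "A\<^sup>2 - 1 = B\<^sup>2 + C\<^sup>2"
    using s by (simp add: A B_def C_def field_simps) algebra
  obtain \<phi> where \<phi>: "0 \<le> \<phi>" "\<phi> \<le> 2 * pi" "B = sqrt (A\<^sup>2 - 1) * cos \<phi>" "C = sqrt (A\<^sup>2 - 1) * sin \<phi>"
    using polar_form[of B C] sq by metis
  have "cauchy_density l2 s2 (l1 + s1 * tan t) / cauchy_density l1 s1 (l1 + s1 * tan t)
      = 1 / (A + sqrt (A\<^sup>2 - 1) * cos (2 * t - \<phi>))" if t: "cos t \<noteq> 0" for t
  proof -
    have "A + sqrt (A\<^sup>2 - 1) * cos (2 * t - \<phi>) = A + B * cos (2 * t) + C * sin (2 * t)"
      by (subst \<phi>(3), subst \<phi>(4)) (simp add: cos_diff algebra_simps)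
    \<comment> \<open>Multiplying \<open>A\<close> by \<open>sin\<^sup>2 + cos\<^sup>2\<close> makes
      everything homogeneous of degree 2, so the comparison below is a polynomial identity in two
      free variables.\<close>
    also have "\<dots> = A * ((sin t)\<^sup>2 + (cos t)\<^sup>2) + B * ((cos t)\<^sup>2 - (sin t)\<^sup>2) + C * (2 * sin t * cos t)"
      by (simp add: cos_double sin_double)
    also have "\<dots> = ((s1\<^sup>2 + s2\<^sup>2 + d\<^sup>2) * ((sin t)\<^sup>2 + (cos t)\<^sup>2)
        + (s2\<^sup>2 + d\<^sup>2 - s1\<^sup>2) * ((cos t)\<^sup>2 - (sin t)\<^sup>2) + 2 * d * s1 * (2 * sin t * cos t))
        / (2 * s1 * s2)"
    proof -
      have "C = 2 * d * s1 / (2 * s1 * s2)" using s by (simp add: C_def)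
      then show ?thesis
        by (simp only: A B_def add_divide_distrib[where c = "2 * s1 * s2"] distrib_right
            times_divide_eq_left)
    qed
    also have "\<dots> = 2 * (s2\<^sup>2 * (cos t)\<^sup>2 + (d * cos t + s1 * sin t)\<^sup>2) / (2 * s1 * s2)"
    proof -
      have "(s1\<^sup>2 + s2\<^sup>2 + d\<^sup>2) * (x\<^sup>2 + y\<^sup>2) + (s2\<^sup>2 + d\<^sup>2 - s1\<^sup>2) * (y\<^sup>2 - x\<^sup>2)
          + 2 * d * s1 * (2 * x * y) = 2 * (s2\<^sup>2 * y\<^sup>2 + (d * y + s1 * x)\<^sup>2)" for x y
        by algebra
      then show ?thesis by (simp only:)
    qed
    also have "\<dots> = (s2\<^sup>2 * (cos t)\<^sup>2 + (d * cos t + s1 * sin t)\<^sup>2) / (s1 * s2)"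
      by (simp del: distrib_left_numeral)
    finally have den: "A + sqrt (A\<^sup>2 - 1) * cos (2 * t - \<phi>)
      = (s2\<^sup>2 * (cos t)\<^sup>2 + (d * cos t + s1 * sin t)\<^sup>2) / (s1 * s2)" .
    have num: "s2\<^sup>2 + (d + s1 * tan t)\<^sup>2
      = (s2\<^sup>2 * (cos t)\<^sup>2 + (d * cos t + s1 * sin t)\<^sup>2) / (cos t)\<^sup>2"
      using t by (simp add: tan_def field_simps)
    have "cauchy_density l2 s2 (l1 + s1 * tan t) = s2 / (pi * (s2\<^sup>2 + (d + s1 * tan t)\<^sup>2))"
      by (simp add: cauchy_density_def d_def algebra_simps)
    also have "\<dots> / cauchy_density l1 s1 (l1 + s1 * tan t)
      = s1 * s2 / (s2\<^sup>2 * (cos t)\<^sup>2 + (d * cos t + s1 * sin t)\<^sup>2)"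
      unfolding num cauchy_density_tan[OF s(1) t] using t s by simp
    finally show ?thesis unfolding den by simp
  qed
  then show ?thesis using that \<phi> unfolding A_def by blast
qed

text \<open>After the tangent substitution the integrand extends continuously to the closed interval
  of angles, so it is integrable with no growth condition on \<open>f\<close>. Periodicity then
  removes the phase.\<close>

lemma f_div_cauchy:
  assumes f: "continuous_on {0<..} f" and s: "s1 > 0" "s2 > 0"
  shows "f_div_integrable f UNIV (cauchy_density l1 s1) (cauchy_density l2 s2)"
    and "f_div f UNIV (cauchy_density l1 s1) (cauchy_density l2 s2)
       = cauchy_angle_integral f (cauchy_chi (l1, s1) (l2, s2))"
proof -
  define c where "c = cauchy_chi (l1, s1) (l2, s2)"
  have c: "c \<ge> 0" unfolding c_def using s by (rule cauchy_chi_nonneg)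
  obtain \<phi> where \<phi>: "0 \<le> \<phi>" "\<phi> \<le> 2 * pi" and ratio: "\<And>t. cos t \<noteq> 0 \<Longrightarrow>
       cauchy_density l2 s2 (l1 + s1 * tan t) / cauchy_density l1 s1 (l1 + s1 * tan t)
       = 1 / (1 + c + sqrt ((1 + c)\<^sup>2 - 1) * cos (2 * t - \<phi>))"
    using cauchy_ratio_tan[OF s] unfolding c_def by blast
  define v where "v t = f (1 / (1 + c + sqrt ((1 + c)\<^sup>2 - 1) * cos (2 * t)))" for t
  \<comment> \<open>The shift is \<open>\<phi> / 2\<close> because \<open>v\<close> depends on
    \<open>2 * t\<close>.\<close>
  define u where "u t = v (t - \<phi> / 2) / pi" for t
  define k where "k x = cauchy_density l1 s1 x *
    f (cauchy_density l2 s2 x / cauchy_density l1 s1 x)" for x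
  let ?I = "{-(pi/2)<..<pi/2}"
  define g where "g t = l1 + s1 * tan t" for t
  have den: "1 + c + sqrt ((1 + c)\<^sup>2 - 1) * cos t > 0" for t
    using c by (rule angle_denominator_pos)
  have cont_v: "continuous_on X v" for X
    unfolding v_def
    by (intro continuous_on_compose2[OF f] continuous_intros)
      (auto simp: den less_imp_neq[OF den, symmetric])
  have cont_u: "continuous_on X u" for X
    unfolding u_def
    by (intro continuous_on_divide continuous_on_compose2[OF cont_v[of UNIV]] continuous_intros) auto
  have cos: "cos t > 0" if "t \<in> ?I" for t
    using that by (intro cos_gt_zero_pi) auto
  have u: "\<bar>s1 / (cos t)\<^sup>2\<bar> * k (g t) = u t" if "t \<in> ?I" for t
  proof -
    have ct: "cos t \<noteq> 0" using cos[OF that] by simp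
    have "cauchy_density l1 s1 (g t) = (cos t)\<^sup>2 / (pi * s1)"
      unfolding g_def using s(1) ct by (rule cauchy_density_tan)
    then show ?thesis
      using ratio[OF ct] ct s by (simp add: k_def u_def v_def g_def right_diff_distrib)
  qed
  have range: "g ` ?I = UNIV"
  proof -
    have "x = g (arctan ((x - l1) / s1))" for x
      using s by (simp add: g_def tan_arctan)
    moreover have "arctan y \<in> ?I" for y
      using arctan_bounded[of y] by simp
    ultimately show ?thesis by blast
  qed
  have inj: "inj_on g ?I"
    by (rule inj_on_inverseI[where g = "\<lambda>x. arctan ((x - l1) / s1)"])
      (use s in \<open>auto simp: g_def intro!: arctan_tan\<close>)
  \<comment> \<open>Unlike \<open>g\<close>, the function \<open>u\<close> is continuous up to the
    endpoints, so compactness applies.\<close>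
  have "set_integrable lborel {-(pi/2)..pi/2} u"
    unfolding set_integrable_def by (rule borel_integrable_compact[OF compact_Icc cont_u])
  then have int_u: "set_integrable lborel ?I u"
    by (rule set_integrable_subset) auto
  have cont_k: "continuous_on X k" for X
    unfolding k_def by (rule continuous_on_cauchy_integrand[OF f s])
  have der: "(g has_real_derivative s1 / (cos t)\<^sup>2) (at t)" if "t \<in> ?I" for t
    unfolding g_def using cos[OF that]
    by (auto intro!: derivative_eq_intros simp: field_simps)
  have sub: "set_integrable lborel (g ` ?I) k"
    "set_lebesgue_integral lborel (g ` ?I) k = set_lebesgue_integral lborel ?I u"
    by (rule set_integral_substitution_lborel[OF _ _ der inj cont_k u cont_u int_u];
        simp add: range)+
  show "f_div_integrable f UNIV (cauchy_density l1 s1) (cauchy_density l2 s2)"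
    using sub(1) unfolding f_div_integrable_def k_def range .
  have "f_div f UNIV (cauchy_density l1 s1) (cauchy_density l2 s2) = set_lebesgue_integral lborel ?I u"
    using sub(2) unfolding f_div_def k_def range .
  also have "\<dots> = integral ?I u"
    using int_u by (rule set_borel_integral_eq_integral)
  also have "\<dots> = integral {-(pi/2)..pi/2} u"
    by (rule integral_open_interval_real[symmetric])
  also have "\<dots> = integral {-(pi/2)..pi/2} (\<lambda>t. v (t - \<phi> / 2)) / pi"
    unfolding u_def by simp
  also have "integral {-(pi/2)..pi/2} (\<lambda>t. v (t - \<phi> / 2)) = integral {-(pi/2)..pi/2} v"
  proof -
    have "v (t + pi) = v t" for t
      by (simp add: v_def distrib_left)
    then show ?thesis
      using integral_periodic[OF cont_v, of pi "\<phi> / 2" "-(pi/2)"] \<phi> by simp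
  qed
  also have "\<dots> / pi = cauchy_angle_integral f c"
    unfolding v_def cauchy_angle_integral_def ..
  finally show "f_div f UNIV (cauchy_density l1 s1) (cauchy_density l2 s2)
       = cauchy_angle_integral f (cauchy_chi (l1, s1) (l2, s2))"
    unfolding c_def .
qed

section \<open>Symmetry and conclusion\<close>

lemma cauchy_chi_commute: "cauchy_chi p q = cauchy_chi q p"
  by (cases p; cases q) (simp add: cauchy_chi_def power2_commute mult.commute mult.left_commute)

theorem theorem6:
  fixes f :: "real \<Rightarrow> real"
  assumes "convex_on {0<..} f"
    and "strictly_convex_at {0<..} f 1"
    and "f 1 = 0"
  shows "(\<forall>\<mu>1 \<mu>2 \<sigma>1 \<sigma>2. \<sigma>1 > 0 \<and> \<sigma>2 > 0 \<longrightarrow>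
            f_div_integrable f {0<..} (log_cauchy_density \<mu>1 \<sigma>1) (log_cauchy_density \<mu>2 \<sigma>2) \<and>
            f_div_integrable f UNIV (cauchy_density \<mu>1 \<sigma>1) (cauchy_density \<mu>2 \<sigma>2) \<and>
            f_div f {0<..} (log_cauchy_density \<mu>1 \<sigma>1) (log_cauchy_density \<mu>2 \<sigma>2)
              = f_div f UNIV (cauchy_density \<mu>1 \<sigma>1) (cauchy_density \<mu>2 \<sigma>2))
       \<and> (\<forall>\<mu>1 \<mu>2 \<sigma>1 \<sigma>2. \<sigma>1 > 0 \<and> \<sigma>2 > 0 \<longrightarrow>
            f_div f {0<..} (log_cauchy_density \<mu>1 \<sigma>1) (log_cauchy_density \<mu>2 \<sigma>2)
              = f_div f {0<..} (log_cauchy_density \<mu>2 \<sigma>2) (log_cauchy_density \<mu>1 \<sigma>1))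
       \<and> (\<exists>h :: real \<Rightarrow> real. \<forall>\<mu>1 \<mu>2 \<sigma>1 \<sigma>2. \<sigma>1 > 0 \<and> \<sigma>2 > 0 \<longrightarrow>
            f_div f {0<..} (log_cauchy_density \<mu>1 \<sigma>1) (log_cauchy_density \<mu>2 \<sigma>2)
              = h (cauchy_chi (\<mu>1, \<sigma>1) (\<mu>2, \<sigma>2)))"
proof -
  \<comment> \<open>Convexity enters as continuity on the open half-line.\<close>
  have f: "continuous_on {0<..} f"
    using assms(1) by (intro convex_on_continuous) auto
  have div: "f_div f {0<..} (log_cauchy_density \<mu>1 \<sigma>1) (log_cauchy_density \<mu>2 \<sigma>2)
      = cauchy_angle_integral f (cauchy_chi (\<mu>1, \<sigma>1) (\<mu>2, \<sigma>2))"
    if "\<sigma>1 > 0" "\<sigma>2 > 0" for \<mu>1 \<mu>2 \<sigma>1 \<sigma>2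
    using f_div_log_cauchy(2)[OF f that] f_div_cauchy[OF f that] by simp
  \<comment> \<open>\<open>cauchy_angle_integral f\<close> serves as \<open>h\<close>; symmetry of
    the divergence is inherited from \<open>cauchy_chi\<close>.\<close>
  show ?thesis
    using f_div_log_cauchy[OF f] f_div_cauchy[OF f] div cauchy_chi_commute by metis
qed

end
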